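(* Let $q$ be a prime power with $q+1\equiv 2\pmod 6$, and let $\xi$ be a primitive element of $\mathbb{F}_{q^2}$. Let $b,c\in\mathbb{F}_{q^2}$ and $j\in\mathbb{Z}$ satisfy $b=\xi^{(q-1)2j}$ and $c^{q}=b^{q}c$. Let $k\in\{1,2\}$ and define $$f(x)=(x^{q}+bx+c)^{\frac{k(q^2-1)}{6}+1}-bx.$$ Let $\omega=\xi^{(q^2-1)/3}$. Then $f(x)$ is a permutation polynomial of $\mathbb{F}_{q^2}$ if and only if $$\Big((2\omega^{k}-1)^{\frac{q^2-1}{6}},\ (2\omega^{2k}-1)^{\frac{q^2-1}{6}}\Big)=(1,1)\ \text{ or }\ (\omega,\omega^{2}).$$
   Context: A polynomial is a permutation polynomial of $\mathbb{F}_{q^2}$ if the map it induces on $\mathbb{F}_{q^2}$ is a bijection. *)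

theory Defs
  imports
    "HOL-Library.Cardinality"
    "HOL-Computational_Algebra.Polynomial"
    "HOL-Number_Theory.Cong"
    "HOL-Number_Theory.Prime_Powers"
begin

definition permutation_poly :: "'a :: {field, finite} poly \<Rightarrow> bool" where
  "permutation_poly f \<longleftrightarrow> bij (poly f)"

text \<open>
  A primitive element is a generator of the cyclic group of nonzero elements. Since this group
  is finite, natural exponents suffice. The element \<open>0\<close> is excluded because all
  powers have to be nonzero.
\<close>
definition primitive_element :: "'a :: {field, finite} \<Rightarrow> bool" where
  "primitive_element \<xi> \<longleftrightarrow> range (\<lambda>n :: nat. \<xi> ^ n) = UNIV - {0}"

end

(* Put u = x^q + b x + c and s = (q^2 - 1) / 6. The values of u lie in the q-element set V of
   solutions of u^q = b^q u, and b f(x)^q + f(x) = g(u) + c with g(u) = u (2 u^(k s) - 1). The kernel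
   of y |-> b y^q + y has at most q elements, so f permutes the field iff g is injective on V.
   As the exponent 2j of xi^(q-1) in b is even, u^s is a cube root of unity for every nonzero u in V,
   and all three roots occur. On the class of u with u^s = e, g multiplies by a(e) = 2 e^k - 1,
   an element of the subfield with q elements, so it moves this class to that of e a(e)^s. Hence g is
   injective iff a is nonzero and e |-> e a(e)^s permutes {1, omega, omega^2}; since a(1) = 1,
   this permutation fixes omega and omega^2 or swaps them. *)
theory Submission
  imports Defs
begin

section \<open>Frobenius additivity and the cyclic group of nonzero elements\<close>

text \<open>The sum of all field elements is unchanged by the shift \<open>z + 1\<close>, so
  \<open>CARD('a)\<close> vanishes in the field. This identifies the characteristic with the prime
  below \<open>q\<close>.\<close>

lemma frobenius_add:
  fixes x y :: "'a :: {field, finite}"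
  assumes "primepow q" and "CARD('a) = q ^ m"
  shows "(x + y) ^ q = x ^ q + y ^ q"
proof -
  obtain p e where p: "prime p" and q: "q = p ^ e"
    using assms(1) unfolding primepow_def by blast
  have prime: "prime CHAR('a)"
    by (rule prime_CHAR_semidom, rule finite_imp_CHAR_pos) simp
  have "(\<Sum>z\<in>UNIV. z) = (\<Sum>z\<in>UNIV. z + 1 :: 'a)"
    by (rule sum.reindex_bij_witness[of _ "\<lambda>z. z + 1" "\<lambda>z. z - 1"]) auto
  hence "of_nat CARD('a) = (0 :: 'a)" by (simp add: sum.distrib)
  hence "CHAR('a) dvd p ^ (e * m)"
    using assms(2) q by (simp only: of_nat_eq_0_iff_char_dvd power_mult)
  hence "CHAR('a) = p"
    using prime p by (metis prime_dvd_power primes_dvd_imp_eq)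
  thus ?thesis
    using prime q by (intro freshmans_dream') simp_all
qed

lemma primitive_element_nonzero: "primitive_element \<xi> \<Longrightarrow> \<xi> \<noteq> 0"
  unfolding primitive_element_def by (metis DiffD2 insertI1 power_one_right rangeI)

text \<open>If \<open>\<xi> ^ i = 1\<close>, powers depend only on the exponent modulo
  \<open>i\<close>, so at most \<open>i\<close> of them are distinct; yet they exhaust the nonzero
  elements.\<close>

lemma primitive_element_order_ge:
  fixes \<xi> :: "'a :: {field, finite}"
  assumes "primitive_element \<xi>" and "\<xi> ^ i = 1" and "i > 0"
  shows "CARD('a) - 1 \<le> i"
proof -
  have "\<xi> ^ m = \<xi> ^ (m mod i)" for m
    by (metis assms(2) div_mult_mod_eq mult.commute mult_1 power_add power_mult power_one)
  hence "range (\<lambda>m::nat. \<xi> ^ m) \<subseteq> (\<lambda>m. \<xi> ^ m) ` {..<i}"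
    using assms(3) by (metis (no_types, lifting) image_iff image_subsetI lessThan_iff mod_less_divisor)
  hence "UNIV - {0} \<subseteq> (\<lambda>m. \<xi> ^ m) ` {..<i}"
    using assms(1) by (simp add: primitive_element_def)
  hence "card (UNIV - {0 :: 'a}) \<le> card {..<i}"
    by (rule surj_card_le[rotated]) simp
  thus ?thesis by (simp add: card_Diff_singleton)
qed

lemma primitive_element_power_card:
  fixes \<xi> :: "'a :: {field, finite}"
  assumes "primitive_element \<xi>"
  shows "\<xi> ^ (CARD('a) - 1) = 1"
proof -
  let ?N = "CARD('a) - 1"
  have nz: "\<xi> \<noteq> 0" using assms by (rule primitive_element_nonzero)
  \<comment> \<open>The exponents 0 to \<open>?N\<close> outnumber the \<open>?N\<close> nonzero
    elements by one. The resulting collision has exponent gap at most \<open>?N\<close>, and the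
    order bound makes it exactly \<open>?N\<close>.\<close>
  have "(\<lambda>m. \<xi> ^ m) ` {..?N} \<subseteq> UNIV - {0}" using nz by auto
  hence "card ((\<lambda>m. \<xi> ^ m) ` {..?N}) \<le> card (UNIV - {0 :: 'a})"
    by (intro card_mono) auto
  also have "\<dots> < card {..?N}" by (simp add: card_Diff_singleton)
  finally have "\<not> inj_on (\<lambda>m. \<xi> ^ m) {..?N}" by (rule pigeonhole)
  then obtain x y where "x \<le> ?N" "y \<le> ?N" "x \<noteq> y" "\<xi> ^ x = \<xi> ^ y"
    by (auto simp: inj_on_def)
  hence "min x y < max x y" "max x y \<le> ?N" "\<xi> ^ min x y = \<xi> ^ max x y"
    by (auto simp: min_def max_def)
  then obtain i k where ik: "i < k" "k \<le> ?N" "\<xi> ^ i = \<xi> ^ k" by blast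
  have "\<xi> ^ k = \<xi> ^ i * \<xi> ^ (k - i)" using ik(1) by (simp flip: power_add)
  with ik(3) nz have one: "\<xi> ^ (k - i) = 1" by simp
  hence "?N \<le> k - i"
    using ik(1) by (intro primitive_element_order_ge[OF assms]) auto
  hence "k - i = ?N" using ik(2) by linarith
  thus ?thesis using one by simp
qed

lemma primitive_element_power_int_eq:
  fixes \<xi> :: "'a :: {field, finite}"
  assumes "primitive_element \<xi>" and "x = y + int (CARD('a) - 1) * z"
  shows "\<xi> powi x = \<xi> powi y"
proof -
  have "\<xi> powi (int (CARD('a) - 1) * z) = 1"
    using primitive_element_power_card[OF assms(1)] by (simp only: power_int_mult power_int_of_nat power_int_1_left)
  thus ?thesis
    using primitive_element_nonzero[OF assms(1)] assms(2) by (simp add: power_int_add)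
qed

lemma nonzero_power_card:
  fixes x \<xi> :: "'a :: {field, finite}"
  assumes "primitive_element \<xi>" and "x \<noteq> 0"
  shows "x ^ (CARD('a) - 1) = 1"
proof -
  obtain m :: nat where "x = \<xi> ^ m"
    using assms unfolding primitive_element_def by blast
  thus ?thesis
    using primitive_element_power_card[OF assms(1)] by (metis mult.commute power_mult power_one)
qed

section \<open>Counting roots and fibres\<close>

text \<open>Serves twice: it bounds both the set \<open>V\<close> and the kernel of
  \<open>y \<mapsto> b * y ^ q + y\<close>.\<close>

lemma card_power_eq_scale_le:
  fixes d :: "'a :: {field, finite}"
  assumes "q > 1"
  shows "card {x :: 'a. x ^ q = d * x} \<le> q"
proof -
  let ?p = "monom 1 q + [:0, - d:]"
  have deg: "degree ?p = q"
    using assms degree_pCons_le[of 0 "[:- d:]"]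
    by (subst degree_add_eq_left) (auto simp: degree_monom_eq)
  hence "?p \<noteq> 0" using assms by (metis degree_0 not_one_less_zero)
  hence "card {x. poly ?p x = 0} \<le> q" using card_poly_roots_bound deg by metis
  thus ?thesis by (simp add: poly_monom mult.commute)
qed

text \<open>Each nonempty fibre lies in a translate of the kernel, so fibres of size at most
  \<open>q\<close> need at least \<open>m\<close> values to cover the domain.\<close>

lemma card_range_additive_ge:
  fixes h :: "'a :: {ab_group_add, finite} \<Rightarrow> 'b :: ab_group_add"
  assumes add: "\<And>x y. h (x - y) = h x - h y"
    and ker: "card {x. h x = 0} \<le> q" and card: "CARD('a) = q * m" and "q > 0"
  shows "m \<le> card (range h)"
proof -
  have fib: "card (h -` {v}) \<le> q" if v: "v \<in> range h" for v
  proof -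
    obtain y where y: "v = h y" using v by blast
    have "h -` {v} \<subseteq> (\<lambda>x. x + y) ` {x. h x = 0}"
    proof
      fix x assume "x \<in> h -` {v}"
      hence "h (x - y) = 0" by (simp add: add y)
      thus "x \<in> (\<lambda>x. x + y) ` {x. h x = 0}" by (intro image_eqI[of _ _ "x - y"]) auto
    qed
    hence "card (h -` {v}) \<le> card {x. h x = 0}"
      by (rule surj_card_le[rotated]) simp
    thus ?thesis using ker by simp
  qed
  have "(\<Union>v\<in>range h. h -` {v}) = UNIV" by auto
  hence "q * m = card (\<Union>v\<in>range h. h -` {v})" using card by simp
  also have "\<dots> \<le> (\<Sum>v\<in>range h. card (h -` {v}))" by (rule card_UN_le) simp
  also have "\<dots> \<le> (\<Sum>v\<in>range h. q)" by (rule sum_mono) (rule fib)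
  finally show ?thesis using \<open>q > 0\<close> by simp
qed

section \<open>Reduction to \<open>V\<close> and then to classes of equal \<open>s\<close>-th
  power\<close>

text \<open>\<open>\<phi>\<close> abstracts the power \<open>u ^ (k * s)\<close>; all that matters
  is that the \<open>q\<close>-th power map fixes its values on nonzero elements of
  \<open>V\<close>. One direction is a count, so surjectivity of \<open>?u\<close> onto
  \<open>V\<close> is never shown.\<close>

lemma bij_iff_inj_on_twisted_fixed:
  fixes q :: nat and b c :: "'a :: {field, finite}" and \<phi> :: "'a \<Rightarrow> 'a"
  defines "V \<equiv> {u. u ^ q = b ^ q * u}"
  assumes q: "primepow q" and card: "CARD('a) = q ^ 2"
    and Fr: "\<And>x :: 'a. x ^ q ^ 2 = x"
    and b: "b ^ q * b = 1" and c: "c ^ q = b ^ q * c"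
    and \<phi>: "\<And>u. u \<in> V \<Longrightarrow> u \<noteq> 0 \<Longrightarrow> \<phi> u ^ q = \<phi> u"
  shows "bij (\<lambda>x. (x ^ q + b * x + c) * \<phi> (x ^ q + b * x + c) - b * x) \<longleftrightarrow>
    inj_on (\<lambda>u. u * (2 * \<phi> u - 1)) V"
proof -
  let ?u = "\<lambda>x. x ^ q + b * x + c"
  let ?f = "\<lambda>x. ?u x * \<phi> (?u x) - b * x"
  let ?g = "\<lambda>u. u * (2 * \<phi> u - 1)"
  let ?h = "\<lambda>y. b * y ^ q + y"
  have q1: "q > 1" using primepow_gt_Suc_0[OF q] by simp
  note add = frobenius_add[OF q card]
  have diff: "(x - y) ^ q = x ^ q - y ^ q" for x y :: 'a
    using add[of "x - y" y] by (simp add: algebra_simps)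
  have Fr': "(x ^ q) ^ q = x" for x :: 'a
    using Fr[of x] by (simp add: power2_eq_square power_mult)
  have uV: "?u x \<in> V" for x
  proof -
    have "?u x ^ q = x + b ^ q * x ^ q + b ^ q * c"
      by (simp add: add c power_mult_distrib Fr')
    also have "\<dots> = b ^ q * b * x + b ^ q * x ^ q + b ^ q * c" by (simp add: b)
    finally show ?thesis by (simp add: V_def algebra_simps)
  qed
  \<comment> \<open>Since \<open>b ^ q * b = 1\<close>, both summands of \<open>?h\<close>
    contribute \<open>?u x * \<phi> (?u x)\<close>, and the remaining terms
    \<open>- x ^ q - b * x\<close> equal \<open>c - ?u x\<close>.\<close>
  have hf: "?h (?f x) = ?g (?u x) + c" for x
  proof -
    have u: "?u x ^ q = b ^ q * ?u x" using uV[of x] by (simp add: V_def)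
    have "(?u x * \<phi> (?u x)) ^ q = b ^ q * ?u x * \<phi> (?u x)"
      using \<phi>[OF uV[of x]] q1 by (cases "?u x = 0") (auto simp: power_mult_distrib u)
    hence "b * ?f x ^ q = b * (b ^ q * ?u x * \<phi> (?u x) - b ^ q * x ^ q)"
      by (simp add: diff power_mult_distrib)
    also have "\<dots> = (b ^ q * b) * (?u x * \<phi> (?u x) - x ^ q)" by (simp add: algebra_simps)
    also have "\<dots> = ?u x * \<phi> (?u x) - x ^ q" by (simp only: b mult_1)
    finally show ?thesis by (simp add: algebra_simps)
  qed
  show ?thesis
  proof
    assume bij: "bij ?f"
    have "range ?h = ?h ` range ?f" by (simp only: bij_is_surj[OF bij])
    also have "\<dots> = range (\<lambda>x. ?h (?f x))" by (rule image_image)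
    also have "\<dots> = range (\<lambda>x. ?g (?u x) + c)" by (simp only: hf)
    also have "\<dots> \<subseteq> (\<lambda>v. v + c) ` ?g ` V" using uV by blast
    finally have sub: "range ?h \<subseteq> (\<lambda>v. v + c) ` ?g ` V" .
    have bnz: "b \<noteq> 0" using b by auto
    have eq: "{x. ?h x = 0} = {x. x ^ q = - inverse b * x}"
      using bnz by (auto simp: field_simps eq_neg_iff_add_eq_0)
    have "q \<le> card (range ?h)"
    proof (rule card_range_additive_ge)
      show "card {x. ?h x = 0} \<le> q" unfolding eq by (rule card_power_eq_scale_le[OF q1])
      show "CARD('a) = q * q" using card by (simp add: power2_eq_square)
      show "?h (x - y) = ?h x - ?h y" for x y by (simp add: diff algebra_simps)
    qed (use q1 in simp)
    also have "\<dots> \<le> card ((\<lambda>v. v + c) ` ?g ` V)" using sub by (intro card_mono) auto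
    also have "\<dots> \<le> card (?g ` V)" by (rule card_image_le) simp
    \<comment> \<open>Squeeze: \<open>V\<close> has at most \<open>q\<close> elements and its image
      at least \<open>q\<close>.\<close>
    finally have "card V \<le> card (?g ` V)"
      using card_power_eq_scale_le[OF q1, of "b ^ q"] by (simp add: V_def)
    hence "card (?g ` V) = card V" by (simp add: card_image_le le_antisym)
    thus "inj_on ?g V" by (intro eq_card_imp_inj_on) auto
  next
    assume inj: "inj_on ?g V"
    have "inj ?f"
    proof
      fix x y assume *: "?f x = ?f y"
      hence "?g (?u x) = ?g (?u y)" using hf[of x] hf[of y] by simp
      hence u: "?u x = ?u y" using inj uV by (meson inj_onD)
      have "b * x = b * y" using * unfolding u by simp
      thus "x = y" using b by auto
    qed
    thus "bij ?f" by (simp add: bij_def finite_UNIV_inj_surj)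
  qed
qed

text \<open>If \<open>u ^ s = \<epsilon>\<close>, the \<open>s\<close>-th power of the image of
  \<open>u\<close> is \<open>\<epsilon> * a \<epsilon> ^ s\<close>, so the map acts on classes.
  Within one class it is a plain scaling, injective when the factor is nonzero; a zero factor would
  cause a collision with 0.\<close>

lemma inj_on_classwise_scaling_iff:
  fixes V T :: "'a :: field set" and a :: "'a \<Rightarrow> 'a"
  assumes "s > 0" and zero: "0 \<in> V"
    and pow_mem: "\<And>u. u \<in> V \<Longrightarrow> u \<noteq> 0 \<Longrightarrow> u ^ s \<in> T"
    and ex: "\<And>\<epsilon>. \<epsilon> \<in> T \<Longrightarrow> \<exists>u\<in>V. u \<noteq> 0 \<and> u ^ s = \<epsilon>"
    and scale: "\<And>u \<epsilon> \<delta>. u \<in> V \<Longrightarrow> \<epsilon> \<in> T \<Longrightarrow> \<delta> \<in> T \<Longrightarrow> a \<epsilon> / a \<delta> * u \<in> V"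
  shows "inj_on (\<lambda>u. u * a (u ^ s)) V \<longleftrightarrow>
    (\<forall>\<epsilon>\<in>T. a \<epsilon> \<noteq> 0) \<and> inj_on (\<lambda>\<epsilon>. \<epsilon> * a \<epsilon> ^ s) T"
proof (intro iffI conjI ballI inj_onI notI)
  fix \<epsilon> assume inj: "inj_on (\<lambda>u. u * a (u ^ s)) V" and e: "\<epsilon> \<in> T" "a \<epsilon> = 0"
  obtain u where "u \<in> V" "u \<noteq> 0" "u ^ s = \<epsilon>" using ex e by blast
  thus False using inj_onD[OF inj, of u 0] e zero by simp
next
  fix \<epsilon> \<delta>
  assume inj: "inj_on (\<lambda>u. u * a (u ^ s)) V" and T: "\<epsilon> \<in> T" "\<delta> \<in> T"
    and eq: "\<epsilon> * a \<epsilon> ^ s = \<delta> * a \<delta> ^ s"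
  have nz: "a \<delta> \<noteq> 0"
  proof
    assume d: "a \<delta> = 0"
    obtain u where "u \<in> V" "u \<noteq> 0" "u ^ s = \<delta>" using ex T by blast
    thus False using inj_onD[OF inj, of u 0] d zero by simp
  qed
  obtain u where u: "u \<in> V" "u \<noteq> 0" "u ^ s = \<epsilon>" using ex T by blast
  \<comment> \<open>Chosen so that \<open>w * a \<delta> = u * a \<epsilon>\<close>; the assumed
    equality puts \<open>w\<close> into the class of \<open>\<delta>\<close>, turning a collision of
    classes into one of elements.\<close>
  define w where "w = a \<epsilon> / a \<delta> * u"
  have ws: "w ^ s = \<delta>"
    using eq nz by (simp add: w_def u power_mult_distrib power_divide field_simps)
  have "u = w"
  proof (rule inj_onD[OF inj])
    show "u * a (u ^ s) = w * a (w ^ s)"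
      using nz unfolding ws by (simp add: w_def u field_simps)
    show "w \<in> V" unfolding w_def using u T by (intro scale)
  qed fact
  thus "\<epsilon> = \<delta>" using u ws by simp
next
  fix u v
  assume *: "(\<forall>\<epsilon>\<in>T. a \<epsilon> \<noteq> 0) \<and> inj_on (\<lambda>\<epsilon>. \<epsilon> * a \<epsilon> ^ s) T"
    and uv: "u \<in> V" "v \<in> V" and eq: "u * a (u ^ s) = v * a (v ^ s)"
  show "u = v"
  proof (cases "u = 0 \<or> v = 0")
    case True
    thus ?thesis using * uv eq pow_mem by (metis mult_eq_0_iff)
  next
    case False
    hence T: "u ^ s \<in> T" "v ^ s \<in> T" using uv pow_mem by auto
    have "u ^ s * a (u ^ s) ^ s = v ^ s * a (v ^ s) ^ s"
      using eq by (metis power_mult_distrib)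
    hence "u ^ s = v ^ s" using * T by (metis (no_types, lifting) inj_onD)
    thus ?thesis using eq * T by auto
  qed
qed

section \<open>Cube roots of unity\<close>

text \<open>A root \<open>\<omega> \<noteq> 1\<close> satisfies
  \<open>1 + \<omega> + \<omega> ^ 2 = 0\<close>, which kills the middle coefficients of the product
  of the three linear factors and leaves \<open>x ^ 3 - 1\<close>.\<close>

lemma cube_roots_of_unity:
  fixes \<omega> x :: "'a :: field"
  assumes "\<omega> ^ 3 = 1" and "\<omega> \<noteq> 1" and "x ^ 3 = 1"
  shows "x \<in> {1, \<omega>, \<omega> ^ 2}"
proof -
  have "(\<omega> - 1) * (1 + \<omega> + \<omega> ^ 2) = \<omega> ^ 3 - 1"
    by (simp add: algebra_simps power2_eq_square power3_eq_cube)
  hence sum: "1 + \<omega> + \<omega> ^ 2 = 0"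
    by (metis assms(1,2) mult_eq_0_iff right_minus_eq)
  have "(x - 1) * (x - \<omega>) * (x - \<omega> ^ 2) =
      x ^ 3 - \<omega> ^ 3 - (1 + \<omega> + \<omega> ^ 2) * x ^ 2 + (1 + \<omega> + \<omega> ^ 2) * \<omega> * x"
    by (simp add: algebra_simps power2_eq_square power3_eq_cube)
  also have "\<dots> = 0" by (simp add: sum assms)
  finally show ?thesis by auto
qed

text \<open>As 1 is fixed, an injective map must keep or swap \<open>\<omega>\<close> and
  \<open>\<omega> ^ 2\<close>; these cases are the two listed pairs. The proof checks all nine
  pairs.\<close>

lemma inj_on_cube_roots_iff:
  fixes \<omega> A B :: "'a :: field"
  assumes w: "\<omega> ^ 3 = 1" "\<omega> \<noteq> 1" and A: "A ^ 3 = 1" and B: "B ^ 3 = 1"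
    and m: "m 1 = 1" "m \<omega> = A" "m (\<omega> ^ 2) = B"
  shows "inj_on (\<lambda>\<epsilon>. \<epsilon> * m \<epsilon>) {1, \<omega>, \<omega> ^ 2} \<longleftrightarrow> (A, B) \<in> {(1, 1), (\<omega>, \<omega> ^ 2)}"
proof -
  define v where "v = \<omega> ^ 2"
  have sq: "\<omega> * \<omega> = v" by (simp add: v_def power2_eq_square)
  have "\<omega> * \<omega> * \<omega> = 1" using w(1) by (simp add: power3_eq_cube)
  hence wv: "\<omega> * v = 1" "v * \<omega> = 1" by (simp_all add: mult.assoc flip: sq)
  have vv: "v * v = \<omega>" using sq wv by (metis mult.assoc mult_1)
  have ne: "v \<noteq> 1" "v \<noteq> \<omega>" using sq wv w(2) by auto
  have "A \<in> {1, \<omega>, v}" "B \<in> {1, \<omega>, v}"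
    using cube_roots_of_unity[OF w] A B unfolding v_def by blast+
  moreover have "inj_on (\<lambda>\<epsilon>. \<epsilon> * m \<epsilon>) {1, \<omega>, v} \<longleftrightarrow>
      \<omega> * A \<noteq> 1 \<and> v * B \<noteq> 1 \<and> \<omega> * A \<noteq> v * B"
    using w(2) ne m unfolding inj_on_def v_def[symmetric] by (auto dest: sym)
  ultimately show ?thesis
    using w(2) ne unfolding v_def[symmetric] by (elim insertE emptyE) (simp_all add: sq wv vv)
qed

section \<open>Exponent arithmetic and the criterion\<close>

theorem corollary10:
  fixes q k :: nat
    and j :: int
    and \<xi> \<omega> b c :: "'a :: {field, finite}"
    and f :: "'a poly"
  assumes "primepow q"
    and "[q + 1 = 2] (mod 6)"
    and "CARD('a) = q ^ 2"
    and "primitive_element \<xi>"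
    and "b = \<xi> powi ((int q - 1) * 2 * j)"
    and "c ^ q = b ^ q * c"
    and "k \<in> {1, 2}"
    and "f = (monom 1 q + [:c, b:]) ^ (k * (q ^ 2 - 1) div 6 + 1) - [:0, b:]"
    and "\<omega> = \<xi> ^ ((q ^ 2 - 1) div 3)"
  shows "permutation_poly f \<longleftrightarrow>
    ((2 * \<omega> ^ k - 1) ^ ((q ^ 2 - 1) div 6), (2 * \<omega> ^ (2 * k) - 1) ^ ((q ^ 2 - 1) div 6))
      \<in> {(1, 1), (\<omega>, \<omega> ^ 2)}"
proof -
  have q1: "q > 1" using primepow_gt_Suc_0[OF assms(1)] by simp
  have "q mod 6 = 1"
    using assms(2) unfolding cong_def by presburger
  then obtain r where q: "q = 6 * r + 1" by (metis mult.commute div_mult_mod_eq)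
  have r: "r > 0" using q q1 by simp
  \<comment> \<open>\<open>h\<close> is \<open>(q + 1) / 2\<close>, and \<open>s\<close> is
    \<open>(q - 1) / 3\<close> times \<open>h\<close>, that is
    \<open>(q ^ 2 - 1) / 6\<close>.\<close>
  define h where "h = 3 * r + 1"
  define s where "s = 2 * r * h"
  have n: "q ^ 2 - 1 = 6 * s" by (simp add: q s_def h_def power2_eq_square algebra_simps)
  have s3: "s * 3 = 6 * r * h" by (simp add: s_def)
  have s: "s > 0" using r by (simp add: s_def h_def)
  have N: "CARD('a) - 1 = 6 * s" using assms(3) n by simp
  have div: "(q ^ 2 - 1) div 6 = s" "(q ^ 2 - 1) div 3 = 2 * s" "k * (q ^ 2 - 1) div 6 = k * s"
    unfolding n by simp_all
  have xi: "\<xi> \<noteq> 0" using assms(4) by (rule primitive_element_nonzero)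
  note red = primitive_element_power_int_eq[OF assms(4), unfolded N]
  have Fr: "x ^ q ^ 2 = x" for x :: 'a
  proof (cases "x = 0")
    case False
    have "q ^ 2 = Suc (CARD('a) - 1)" using N n s by linarith
    thus ?thesis using nonzero_power_card[OF assms(4) False] by (simp only: power_Suc mult_1_right)
  qed (use q1 in simp)
  have w: "\<omega> = \<xi> ^ (2 * s)" using assms(9) div by simp
  have w3: "\<omega> ^ 3 = 1"
    using primitive_element_power_card[OF assms(4), unfolded N]
    by (simp add: w mult.commute flip: power_mult)
  have w1: "\<omega> \<noteq> 1"
    using primitive_element_order_ge[OF assms(4), of "2 * s", unfolded N] s by (auto simp: w)
  \<comment> \<open>The even exponent enters here:
    \<open>(q - 1) * 2 * j * h = (q ^ 2 - 1) * j\<close>.\<close>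
  have b2: "b ^ h = 1"
    unfolding assms(5) power_int_power'
    by (subst red[of _ 0 j]) (simp_all add: q s_def h_def algebra_simps)
  have "Suc q = h * 2" by (simp add: q h_def)
  hence "b ^ q * b = (b ^ h) ^ 2" by (metis power_Suc2 power_mult)
  hence bb: "b ^ q * b = 1" by (simp add: b2)
  define V where "V = {u. u ^ q = b ^ q * u}"
  \<comment> \<open>Membership in \<open>V\<close> gives \<open>u ^ (q - 1) = b ^ q\<close>, and
    \<open>3 * s = (q - 1) * h\<close>.\<close>
  have class3: "(u ^ s) ^ 3 = 1" if u: "u \<in> V" "u \<noteq> 0" for u
  proof -
    have "u * u ^ (6 * r) = b ^ q * u" using u(1) by (simp add: V_def q)
    hence "u ^ (6 * r) = b ^ q" using u(2) by simp
    moreover have "(u ^ s) ^ 3 = (u ^ (6 * r)) ^ h"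
      by (simp only: s3 flip: power_mult)
    ultimately have "(u ^ s) ^ 3 = (b ^ h) ^ q" by (simp add: mult.commute flip: power_mult)
    thus ?thesis by (simp add: b2)
  qed
  have fix3: "\<epsilon> ^ q = \<epsilon>" if "\<epsilon> ^ 3 = 1" for \<epsilon> :: 'a
  proof -
    have "\<epsilon> ^ q = (\<epsilon> ^ 3) ^ (2 * r) * \<epsilon>" by (simp add: q mult.commute flip: power_mult)
    thus ?thesis using that by simp
  qed
  define a where "a = (\<lambda>\<epsilon> :: 'a. 2 * \<epsilon> ^ k - 1)"
  have fixa: "a \<epsilon> ^ q = a \<epsilon>" if "\<epsilon> ^ 3 = 1" for \<epsilon>
  proof -
    note add = frobenius_add[OF assms(1,3)]
    have e: "(\<epsilon> ^ k) ^ q = \<epsilon> ^ k"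
      using fix3[OF that] by (metis mult.commute power_mult)
    \<comment> \<open>Adding 1 leaves a sum of two fixed terms, so additivity of the
      \<open>q\<close>-th power suffices.\<close>
    have "a \<epsilon> + 1 = \<epsilon> ^ k + \<epsilon> ^ k" by (simp add: a_def)
    hence "(a \<epsilon> + 1) ^ q = a \<epsilon> + 1" by (simp only: add e)
    thus ?thesis by (simp add: add)
  qed
  have T3: "\<epsilon> ^ 3 = 1" if "\<epsilon> \<in> {1, \<omega>, \<omega> ^ 2}" for \<epsilon>
  proof -
    have "(\<omega> ^ 2) ^ 3 = (\<omega> ^ 3) ^ 2" by (simp flip: power_mult)
    thus ?thesis using that w3 by auto
  qed
  have a3: "(a \<epsilon> ^ s) ^ 3 = 1" if "\<epsilon> ^ 3 = 1" "a \<epsilon> \<noteq> 0" for \<epsilon>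
  proof -
    have "a \<epsilon> * a \<epsilon> ^ (6 * r) = a \<epsilon>" using fixa[OF that(1)] by (simp add: q)
    hence "a \<epsilon> ^ (6 * r) = 1" using that by simp
    moreover have "(a \<epsilon> ^ s) ^ 3 = (a \<epsilon> ^ (6 * r)) ^ h"
      by (simp only: s3 flip: power_mult)
    ultimately show ?thesis by simp
  qed
  have ex: "\<exists>u\<in>V. u \<noteq> 0 \<and> u ^ s = \<omega> ^ i" for i :: nat
  proof (intro bexI conjI)
    \<comment> \<open>A power of \<open>\<xi>\<close> lies in \<open>V\<close> iff its exponent is
      \<open>- 2 * j\<close> modulo \<open>q + 1\<close>, so it is
      \<open>(q + 1) * t - 2 * j\<close>. Its class is \<open>\<omega> ^ i\<close> iff the exponent
      is \<open>2 * i\<close> modulo 6; as \<open>q + 1\<close> is 2 modulo 6,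
      \<open>t = j + i\<close> works.\<close>
    let ?u = "\<xi> powi (int (q + 1) * (j + int i) - 2 * j)"
    show "?u \<noteq> 0" using xi by simp
    have "?u ^ s = \<xi> powi int (2 * s * i)"
      unfolding power_int_power'
      by (rule red[of _ _ "r * (j + int i)"]) (simp add: q s_def h_def algebra_simps)
    thus "?u ^ s = \<omega> ^ i" by (simp only: w power_int_of_nat power_mult)
    have "?u ^ q = \<xi> powi ((int q - 1) * 2 * j * int q + (int (q + 1) * (j + int i) - 2 * j))"
      unfolding power_int_power'
      by (rule red[of _ _ "i - j"]) (simp add: q s_def h_def algebra_simps)
    thus "?u \<in> V" using xi by (simp add: V_def assms(5) power_int_power' power_int_add)
  qed
  \<comment> \<open>Nesting the power as \<open>(u ^ s) ^ k\<close> shows that the factor depends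
    only on the class of \<open>u\<close>.\<close>
  have "poly f = (\<lambda>x. (x ^ q + b * x + c) * ((x ^ q + b * x + c) ^ s) ^ k - b * x)"
    unfolding assms(8) div
    by (auto simp: poly_monom algebra_simps fun_eq_iff simp flip: power_mult)
  hence "permutation_poly f \<longleftrightarrow>
      bij (\<lambda>x. (x ^ q + b * x + c) * ((x ^ q + b * x + c) ^ s) ^ k - b * x)"
    by (simp add: permutation_poly_def)
  also have "\<dots> \<longleftrightarrow> inj_on (\<lambda>u. u * (2 * (u ^ s) ^ k - 1)) V"
    unfolding V_def
  proof (rule bij_iff_inj_on_twisted_fixed[OF assms(1,3) Fr bb assms(6)])
    fix u assume "u \<in> {u. u ^ q = b ^ q * u}" "u \<noteq> 0"
    hence "(u ^ s) ^ q = u ^ s" using class3 fix3 by (simp add: V_def)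
    thus "((u ^ s) ^ k) ^ q = (u ^ s) ^ k" by (metis mult.commute power_mult)
  qed
  also have "\<dots> \<longleftrightarrow> inj_on (\<lambda>u. u * a (u ^ s)) V" by (simp add: a_def)
  also have "\<dots> \<longleftrightarrow> (\<forall>\<epsilon>\<in>{1, \<omega>, \<omega> ^ 2}. a \<epsilon> \<noteq> 0) \<and>
      inj_on (\<lambda>\<epsilon>. \<epsilon> * a \<epsilon> ^ s) {1, \<omega>, \<omega> ^ 2}"
  proof (rule inj_on_classwise_scaling_iff[OF s])
    show "0 \<in> V" using q1 by (simp add: V_def)
    show "u ^ s \<in> {1, \<omega>, \<omega> ^ 2}" if "u \<in> V" "u \<noteq> 0" for u
      using that class3 by (intro cube_roots_of_unity[OF w3 w1])
    show "\<exists>u\<in>V. u \<noteq> 0 \<and> u ^ s = \<epsilon>" if "\<epsilon> \<in> {1, \<omega>, \<omega> ^ 2}" for \<epsilon>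
      using that ex[of 0] ex[of 1] ex[of 2] by auto
    show "a \<epsilon> / a \<delta> * u \<in> V"
      if "u \<in> V" "\<epsilon> \<in> {1, \<omega>, \<omega> ^ 2}" "\<delta> \<in> {1, \<omega>, \<omega> ^ 2}" for u \<epsilon> \<delta>
      using that(1) fixa[OF T3[OF that(2)]] fixa[OF T3[OF that(3)]]
      by (simp add: V_def power_mult_distrib power_divide)
  qed
  also have "\<dots> \<longleftrightarrow> (a \<omega> ^ s, a (\<omega> ^ 2) ^ s) \<in> {(1, 1), (\<omega>, \<omega> ^ 2)}"
  \<comment> \<open>A vanishing value makes both sides false, because \<open>s > 0\<close> turns it
    into a zero entry of the pair. Otherwise both entries are cube roots of unity.\<close>
  proof (cases "a \<omega> = 0 \<or> a (\<omega> ^ 2) = 0")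
    case True
    hence "a \<omega> ^ s = 0 \<or> a (\<omega> ^ 2) ^ s = 0" using s by (auto simp: zero_power)
    moreover have "\<omega> \<noteq> 0" "\<omega> ^ 2 \<noteq> 0" using w3 by auto
    ultimately have "(a \<omega> ^ s, a (\<omega> ^ 2) ^ s) \<notin> {(1, 1), (\<omega>, \<omega> ^ 2)}"
      by (metis Pair_inject insertE singletonD zero_neq_one)
    moreover have "\<not> (\<forall>\<epsilon>\<in>{1, \<omega>, \<omega> ^ 2}. a \<epsilon> \<noteq> 0)" using True by blast
    ultimately show ?thesis by blast
  next
    case False
    have "a 1 = 1" by (simp add: a_def)
    moreover have "inj_on (\<lambda>\<epsilon>. \<epsilon> * a \<epsilon> ^ s) {1, \<omega>, \<omega> ^ 2} \<longleftrightarrow>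
        (a \<omega> ^ s, a (\<omega> ^ 2) ^ s) \<in> {(1, 1), (\<omega>, \<omega> ^ 2)}"
    proof (rule inj_on_cube_roots_iff[OF w3 w1])
      show "(a \<omega> ^ s) ^ 3 = 1" "(a (\<omega> ^ 2) ^ s) ^ 3 = 1"
        using False a3[OF T3[of \<omega>]] a3[OF T3[of "\<omega> ^ 2"]] by blast+
    qed (simp_all add: \<open>a 1 = 1\<close>)
    ultimately show ?thesis using False by simp
  qed
  finally show ?thesis unfolding a_def div by (simp only: power_mult)
qed

end
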